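(* For every sedenion $v\in S$, write $v=v_1+v_2e_8$ with $v_1,v_2\in\mathbb{O}$, $v_1=x_1e_0+u$, $v_2=x_2e_0+w$, where $x_1,x_2\in\mathbb{R}$ and $u,w\in\operatorname{Im}(\mathbb{O})$, and set \[ D_1(v):=\|v_1\|^2+\|v_2\|^2,\qquad D_2(v):=D_1(v)^2-4\bigl(\|u\|^2\|w\|^2-\langle u,w\rangle^2\bigr). \] Let $L_v\colon S\to S$, $L_v(y)=vy$, be left multiplication by $v$, regarded as a real linear endomorphism of the 16-dimensional real vector space $S$, and let $\Delta(v):=\det L_v$. Then \[ \Delta(v)=D_1(v)^4\,D_2(v)^2 . \] In particular, a nonzero $v\in S$ is a left zero-divisor if and only if $D_2(v)=0$.
   Context: $\mathbb{O}$ is the real algebra of octonions with unit $e_0=1$, conjugation $x\mapsto\overline{x}$, standard Euclidean inner product $\langle\cdot,\cdot\rangle$ and norm $\|\cdot\|$ on $\mathbb{O}\cong\mathbb{R}^8$ (so $x\overline{x}=\|x\|^2e_0$), and $\operatorname{Im}(\mathbb{O})=e_0^{\perp}\cong\mathbb{R}^7$ its subspace of purely imaginary octonions. Concretely, $\mathbb{O}=\mathbb{H}\oplus\mathbb{H}e_4$ with product $(x+ye_4)(z+te_4)=(xz-\overline{t}\,y)+(tx+y\overline{z})e_4$ and conjugation $\overline{x+ye_4}=\overline{x}-ye_4$, where $\mathbb{H}=\operatorname{span}\{e_0,e_1,e_2,e_3\}$ is the quaternion algebra. The sedenion algebra $S$ is the real vector space $\mathbb{O}\oplus\mathbb{O}\cong\mathbb{R}^{16}$,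 whose elements are written uniquely as $v=v_1+v_2e_8$ with $v_1,v_2\in\mathbb{O}$, with multiplication \[ (a+be_8)(c+de_8)=(ac-\overline{d}\,b)+(da+b\overline{c})e_8,\qquad a,b,c,d\in\mathbb{O}. \] An element $v\in S$ is a left zero-divisor if there exists $y\in S$, $y\neq 0$, with $vy=0$. *)

theory Defs
  imports "HOL-Analysis.Analysis"
begin

section \<open>Splitting a doubled coordinate space into two halves\<close>

text \<open>
  The coordinates of a doubled algebra \<open>A \<oplus> A\<close> are indexed by a sum type, so that determinant,
  norm and inner product on it are those of the library. \<open>pair a b\<close> stands for \<open>a + b e\<close>,
  where \<open>e\<close> is the new unit (\<open>e\<^sub>4\<close> for the octonions, \<open>e\<^sub>8\<close> for the sedenions).
\<close>

definition pair :: "real^'n \<Rightarrow> real^'n \<Rightarrow> real^('n + 'n)" where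
  "pair a b = (\<chi> i. case i of Inl j \<Rightarrow> a $ j | Inr j \<Rightarrow> b $ j)"

definition part1 :: "real^('n + 'n) \<Rightarrow> real^'n" where
  "part1 x = (\<chi> j. x $ Inl j)"

definition part2 :: "real^('n + 'n) \<Rightarrow> real^'n" where
  "part2 x = (\<chi> j. x $ Inr j)"

lemma part1_pair [simp]: "part1 (pair a b) = a"
  by (simp add: part1_def pair_def)

lemma part2_pair [simp]: "part2 (pair a b) = b"
  by (simp add: part2_def pair_def)

lemma pair_parts [simp]: "pair (part1 x) (part2 x) = x"
  by (simp add: vec_eq_iff pair_def part1_def part2_def split: sum.split)


section \<open>Quaternions\<close>

text \<open>
  The coordinates \<open>1, 2, 3, 4\<close> belong to \<open>e\<^sub>0, e\<^sub>1, e\<^sub>2, e\<^sub>3\<close>. The componentwise product that the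
  library puts on vectors is never used.
\<close>

type_synonym quaternion = "real^4"

definition quat_mult :: "quaternion \<Rightarrow> quaternion \<Rightarrow> quaternion" where
  "quat_mult x y = vector
     [x$1 * y$1 - x$2 * y$2 - x$3 * y$3 - x$4 * y$4,
      x$1 * y$2 + x$2 * y$1 + x$3 * y$4 - x$4 * y$3,
      x$1 * y$3 - x$2 * y$4 + x$3 * y$1 + x$4 * y$2,
      x$1 * y$4 + x$2 * y$3 - x$3 * y$2 + x$4 * y$1]"

definition quat_cnj :: "quaternion \<Rightarrow> quaternion" where
  "quat_cnj x = vector [x$1, - x$2, - x$3, - x$4]"


section \<open>Octonions\<close>

type_synonym octonion = "real^(4 + 4)"

definition oct_mult :: "octonion \<Rightarrow> octonion \<Rightarrow> octonion" where
  "oct_mult a b =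
     (let x = part1 a; y = part2 a; z = part1 b; t = part2 b in
      pair (quat_mult x z - quat_mult (quat_cnj t) y)
           (quat_mult t x + quat_mult y (quat_cnj z)))"

definition oct_cnj :: "octonion \<Rightarrow> octonion" where
  "oct_cnj a = pair (quat_cnj (part1 a)) (- part2 a)"

definition oct_e0 :: octonion where
  "oct_e0 = axis (Inl 1) 1"

definition oct_Im_space :: "octonion set" where
  "oct_Im_space = {u. u \<bullet> oct_e0 = 0}"

definition oct_re :: "octonion \<Rightarrow> real" where
  "oct_re x = x \<bullet> oct_e0"

definition oct_im :: "octonion \<Rightarrow> octonion" where
  "oct_im x = x - oct_re x *\<^sub>R oct_e0"

lemma norm_oct_e0 [simp]: "norm oct_e0 = 1"
  by (simp add: oct_e0_def)

lemma oct_decomposition: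
  "x = c *\<^sub>R oct_e0 + u \<and> u \<in> oct_Im_space \<longleftrightarrow> c = oct_re x \<and> u = oct_im x"
proof -
  have "oct_e0 \<bullet> oct_e0 = 1" by (simp add: dot_square_norm)
  then show ?thesis
    by (auto simp: oct_Im_space_def oct_re_def oct_im_def inner_add_left inner_diff_left)
qed


section \<open>Sedenions\<close>

type_synonym sedenion = "real^((4 + 4) + (4 + 4))"

definition sed_mult :: "sedenion \<Rightarrow> sedenion \<Rightarrow> sedenion" where
  "sed_mult v y =
     (let a = part1 v; b = part2 v; c = part1 y; d = part2 y in
      pair (oct_mult a c - oct_mult (oct_cnj d) b)
           (oct_mult d a + oct_mult b (oct_cnj c)))"

definition left_zero_divisor :: "sedenion \<Rightarrow> bool" where
  "left_zero_divisor v \<longleftrightarrow> (\<exists>y. y \<noteq> 0 \<and> sed_mult v y = 0)"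

definition left_mult :: "sedenion \<Rightarrow> sedenion \<Rightarrow> sedenion" where
  "left_mult v y = sed_mult v y"

definition \<Delta> :: "sedenion \<Rightarrow> real" where
  "\<Delta> v = det (matrix (left_mult v))"

definition D1 :: "sedenion \<Rightarrow> real" where
  "D1 v = (norm (part1 v))\<^sup>2 + (norm (part2 v))\<^sup>2"

definition D2 :: "sedenion \<Rightarrow> real" where
  "D2 v =
     (let u = oct_im (part1 v); w = oct_im (part2 v) in
      (D1 v)\<^sup>2 - 4 * ((norm u)\<^sup>2 * (norm w)\<^sup>2 - (u \<bullet> w)\<^sup>2))"

text \<open>
  The library's \<open>matrix\<close> only records the images of the unit vectors; it represents \<open>left_mult v\<close>
  because \<open>left_mult v\<close> is linear.
\<close>

lemma vector_4:
  "(vector [a, b, c, d] :: real^4) $ 1 = a" "(vector [a, b, c, d] :: real^4) $ 2 = b"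
  "(vector [a, b, c, d] :: real^4) $ 3 = c" "(vector [a, b, c, d] :: real^4) $ 4 = d"
  by (simp_all add: vector_def)

lemma linear_pair_parts:
  "pair (a + c) (b + d) = pair a b + pair c d" "pair (r *\<^sub>R a) (r *\<^sub>R b) = r *\<^sub>R pair a b"
  "part1 (x + y) = part1 x + part1 y" "part2 (x + y) = part2 x + part2 y"
  "part1 (r *\<^sub>R x) = r *\<^sub>R part1 x" "part2 (r *\<^sub>R x) = r *\<^sub>R part2 x"
  by (simp_all add: vec_eq_iff pair_def part1_def part2_def split: sum.split)

lemma linear_quat:
  "quat_mult (x + x') y = quat_mult x y + quat_mult x' y"
  "quat_mult x (y + y') = quat_mult x y + quat_mult x y'"
  "quat_mult (r *\<^sub>R x) y = r *\<^sub>R quat_mult x y"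
  "quat_mult x (r *\<^sub>R y) = r *\<^sub>R quat_mult x y"
  "quat_cnj (x + y) = quat_cnj x + quat_cnj y"
  "quat_cnj (r *\<^sub>R x) = r *\<^sub>R quat_cnj x"
  by (simp_all add: vec_eq_iff forall_4 quat_mult_def quat_cnj_def vector_4 algebra_simps)

lemma linear_oct:
  "oct_mult (x + x') y = oct_mult x y + oct_mult x' y"
  "oct_mult x (y + y') = oct_mult x y + oct_mult x y'"
  "oct_mult (r *\<^sub>R x) y = r *\<^sub>R oct_mult x y"
  "oct_mult x (r *\<^sub>R y) = r *\<^sub>R oct_mult x y"
  "oct_cnj (x + y) = oct_cnj x + oct_cnj y"
  "oct_cnj (r *\<^sub>R x) = r *\<^sub>R oct_cnj x"
  unfolding oct_mult_def oct_cnj_def Let_def linear_pair_parts(3-) linear_quat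
  by (simp_all flip: linear_pair_parts(1,2) add: algebra_simps)

lemma linear_left_mult: "linear (left_mult v)"
proof (rule linearI)
  show "left_mult v (x + y) = left_mult v x + left_mult v y" for x y
    unfolding left_mult_def sed_mult_def Let_def linear_pair_parts(3-) linear_oct
    by (simp flip: linear_pair_parts(1,2) add: algebra_simps)
  show "left_mult v (r *\<^sub>R x) = r *\<^sub>R left_mult v x" for r x
    unfolding left_mult_def sed_mult_def Let_def linear_pair_parts(3-) linear_oct
    by (simp flip: linear_pair_parts(1,2) add: algebra_simps)
qed

end

theory Submission
  imports Defs
begin

text \<open>
  Write \<open>v = (a, b)\<close> for \<open>v = a + b e\<^sub>8\<close>, and put \<open>v\<^sup>* = (cnj a, - b)\<close>. For the Euclidean inner product,
  the adjoint of \<open>L\<^sub>v\<close> is left multiplication by \<open>v\<^sup>*\<close>, so \<open>\<Delta>(v)\<^sup>2\<close> is the determinant of the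
  operator \<open>G\<^sub>v\<close> that sends \<open>y\<close> to \<open>v\<^sup>* (v y)\<close>. If the octonions were associative this operator would
  be the scalar \<open>D\<^sub>1(v)\<close>; instead
  \<open>G\<^sub>v (c, d) = D\<^sub>1(v) (c, d) + (T d, - T c)\<close> with \<open>T x = (a x) b - a (x b)\<close>,
  and everything depends on the associator map \<open>T\<close> (lemma \<open>left_mult_cnj_left_mult\<close>).

  The associator is alternating and vanishes on real arguments. Hence \<open>T\<close> depends only on the
  imaginary parts \<open>u, w\<close> of \<open>a, b\<close>, and \<open>w\<close> may be replaced by its component \<open>z\<close> orthogonal to \<open>u\<close>.
  By Artin's theorem \<open>T\<close> vanishes on the span of \<open>Q = {1, u, z, u z}\<close>. On the orthogonal complement
  of \<open>Q\<close>, vectors anticommute with \<open>u\<close> and \<open>z\<close> strongly enough to give \<open>T\<^sup>2 = - 4 \<parallel>u\<parallel>\<^sup>2 \<parallel>z\<parallel>\<^sup>2\<close>, and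
  \<open>\<parallel>u\<parallel>\<^sup>2 \<parallel>z\<parallel>\<^sup>2\<close> is the Gram determinant \<open>\<parallel>u\<parallel>\<^sup>2 \<parallel>w\<parallel>\<^sup>2 - \<langle>u, w\<rangle>\<^sup>2\<close>.

  To read off the determinant from \<open>T\<^sup>2\<close> alone, multiply with the same operator for \<open>v' = (a, - b)\<close>:
  passing from \<open>v\<close> to \<open>v'\<close> changes the sign of \<open>T\<close> and, since \<open>L\<^sub>v\<^sub>'\<close> and \<open>L\<^sub>v\<close> are similar, leaves \<open>\<Delta>\<close>
  alone. The product sends \<open>(c, d)\<close> to \<open>(D\<^sub>1\<^sup>2 c + T\<^sup>2 c, D\<^sub>1\<^sup>2 d + T\<^sup>2 d)\<close>. If \<open>u\<close> and \<open>z\<close> are nonzero,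
  it acts as \<open>D\<^sub>1\<^sup>2\<close> on an 8-dimensional space and as \<open>D\<^sub>2\<close> on the orthogonal complement; otherwise
  \<open>D\<^sub>2 = D\<^sub>1\<^sup>2\<close> and it is a scalar. Either way \<open>\<Delta>\<^sup>4 = D\<^sub>1\<^bsup>16\<^esup> D\<^sub>2\<^sup>8\<close> (lemma \<open>\<Delta>_power4\<close>).

  It remains to see that \<open>\<Delta> \<ge> 0\<close>. As \<open>\<langle>y, L\<^sub>v y\<rangle> = x\<^sub>1 \<parallel>y\<parallel>\<^sup>2\<close>, the quadratic form of \<open>L\<^sub>v\<close> or that of
  \<open>L\<^bsub>-v\<^esub> = - L\<^sub>v\<close> is nonnegative. An operator with nonnegative quadratic form has nonnegative
  determinant, because the segment joining it to the identity meets no singular operator except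
  possibly at its end; and \<open>\<Delta>(- v) = \<Delta>(v)\<close> as the dimension is even.

  The zero divisors follow, since \<open>v\<close> is a left zero divisor exactly if \<open>\<Delta>(v) = 0\<close>, and \<open>D\<^sub>1(v) > 0\<close> for
  \<open>v \<noteq> 0\<close>.
\<close>

section \<open>Two facts on determinants\<close>

text \<open>
  Completing \<open>B\<close> to an orthogonal basis diagonalises \<open>F\<close>: the added vectors are orthogonal to \<open>B\<close>,
  hence eigenvectors for \<open>\<beta>\<close>.
\<close>

lemma det_two_eigenspaces:
  fixes F :: "real^'n \<Rightarrow> real^'n"
  assumes "linear F" and B: "pairwise orthogonal B" "0 \<notin> B"
    and \<alpha>: "\<And>x. x \<in> B \<Longrightarrow> F x = \<alpha> *\<^sub>R x"
    and \<beta>: "\<And>x. (\<And>b. b \<in> B \<Longrightarrow> b \<bullet> x = 0) \<Longrightarrow> F x = \<beta> *\<^sub>R x"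
  shows "det (matrix F) = \<alpha> ^ card B * \<beta> ^ (CARD('n) - card B)"
proof -
  obtain U where U: "pairwise orthogonal (B \<union> U)" "span (B \<union> U) = span (B \<union> UNIV)"
    using orthogonal_extension[OF B(1), of UNIV] by metis
  define C where "C = (B \<union> U) - {0}"
  have "B \<subseteq> C" using B by (auto simp: C_def)
  have orth: "pairwise orthogonal C"
    using U(1) unfolding C_def by (rule pairwise_mono) auto
  have "0 \<notin> C" by (simp add: C_def)
  then have indep: "independent C" by (rule pairwise_orthogonal_independent[OF orth])
  have span: "span C = UNIV" using U(2) by (simp add: C_def span_delete_0)
  have "finite C" using orth by (rule pairwise_orthogonal_imp_finite)
  have card: "card C = CARD('n)"
    using dim_eq_card_independent[OF indep] dim_span[of C] span by (metis dim_UNIV DIM_cart DIM_real mult.right_neutral)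
  obtain f :: "'n \<Rightarrow> real^'n" where f: "bij_betw f UNIV C"
    using finite_same_card_bij[OF finite \<open>finite C\<close>] card by metis
  define l where "l x = (if x \<in> B then \<alpha> else \<beta>)" for x
  have l: "F x = l x *\<^sub>R x" if "x \<in> C" for x
  proof (cases "x \<in> B")
    case True then show ?thesis by (simp add: l_def \<alpha>)
  next
    case False
    then have "b \<bullet> x = 0" if "b \<in> B" for b
      using orth that \<open>x \<in> C\<close> \<open>B \<subseteq> C\<close> by (auto simp: pairwise_def orthogonal_def)
    with False show ?thesis by (simp add: l_def \<beta>)
  qed
  define P where "P = (\<chi> i j. f j $ i)"
  define D where "D = (\<chi> i j. if i = j then l (f j) else 0)"
  have colP: "column j P = f j" for j
    by (simp add: column_def P_def vec_eq_iff)
  have "columns P = C"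
    using f by (auto simp: columns_def colP bij_betw_def)
  then have "\<exists>P'. P ** P' = mat 1"
    using span by (simp add: matrix_right_invertible_span_columns span_vec_eq)
  then have "det P \<noteq> 0"
    by (metis invertible_def invertible_det_nz matrix_left_right_inverse)
  have "matrix F ** P = P ** D"
  proof -
    have "(matrix F ** P) $ i $ j = (P ** D) $ i $ j" for i j
    proof -
      have "(matrix F ** P) $ i $ j = (matrix F *v f j) $ i"
        by (simp add: matrix_matrix_mult_def matrix_vector_mult_def P_def)
      also have "\<dots> = (F (f j)) $ i"
        using \<open>linear F\<close> by (simp add: matrix_works)
      also have "\<dots> = l (f j) * f j $ i"
        using l f by (auto simp: bij_betw_def)
      also have "\<dots> = (P ** D) $ i $ j"
        by (simp add: matrix_matrix_mult_def P_def D_def if_distrib cong: if_cong)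
      finally show ?thesis .
    qed
    then show ?thesis by (simp add: vec_eq_iff)
  qed
  then have "det (matrix F) * det P = det P * det D"
    by (metis det_mul)
  with \<open>det P \<noteq> 0\<close> have "det (matrix F) = det D" by simp
  also have "\<dots> = (\<Prod>j\<in>UNIV. l (f j))"
    by (subst det_diagonal) (auto simp: D_def)
  also have "\<dots> = (\<Prod>x\<in>C. l x)"
    using f by (rule prod.reindex_bij_betw)
  also have "\<dots> = (\<Prod>x\<in>B. l x) * (\<Prod>x\<in>C - B. l x)"
    using \<open>finite C\<close> \<open>B \<subseteq> C\<close> by (simp add: prod.subset_diff mult.commute)
  also have "\<dots> = \<alpha> ^ card B * \<beta> ^ card (C - B)"
    by (simp add: l_def)
  also have "card (C - B) = CARD('n) - card B"
    using \<open>finite C\<close> \<open>B \<subseteq> C\<close> card by (simp add: card_Diff_subset finite_subset)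
  finally show ?thesis .
qed

text \<open>
  On the segment from the identity to \<open>F\<close> the quadratic form stays positive definite up to the end
  point, so the determinant, which starts at \<open>1\<close>, cannot vanish before the end point and hence
  cannot become negative.
\<close>

lemma det_nonneg_if_form_nonneg:
  fixes F :: "real^'n \<Rightarrow> real^'n"
  assumes "linear F" and pos: "\<And>y. 0 \<le> y \<bullet> F y"
  shows "0 \<le> det (matrix F)"
proof (rule ccontr)
  assume neg: "\<not> 0 \<le> det (matrix F)"
  define h where "h s = det ((1 - s) *\<^sub>R mat 1 + s *\<^sub>R matrix F)" for s :: real
  have "continuous_on {0..1} h"
    unfolding h_def det_def by (intro continuous_intros) 
  moreover have "h 0 = 1" "h 1 < 0"
    using neg by (simp_all add: h_def)
  ultimately obtain s where s: "0 \<le> s" "s \<le> 1" "h s = 0"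
    using IVT2'[of h 1 0 0] by auto
  then have "s < 1" using \<open>h 1 < 0\<close> by (cases "s = 1") auto
  obtain y where "y \<noteq> 0" "((1 - s) *\<^sub>R mat 1 + s *\<^sub>R matrix F) *v y = 0"
    using s(3) unfolding h_def
    by (metis invertible_det_nz invertible_left_inverse matrix_left_invertible_ker)
  then have "(1 - s) *\<^sub>R y + s *\<^sub>R F y = 0"
    using \<open>linear F\<close> by (simp add: matrix_vector_mult_add_rdistrib matrix_works scaleR_matrix_vector_assoc[symmetric])
  then have "(1 - s) * (y \<bullet> y) + s * (y \<bullet> F y) = 0"
    by (metis inner_add_right inner_scaleR_right inner_zero_right)
  moreover have "0 < (1 - s) * (y \<bullet> y)" "0 \<le> s * (y \<bullet> F y)"
    using \<open>s < 1\<close> \<open>y \<noteq> 0\<close> s pos by auto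
  ultimately show False by linarith
qed

section \<open>Octonion identities\<close>

notation oct_mult (infixl "\<odot>" 70)

lemma forall_sum: "(\<forall>i::'a + 'b. P i) \<longleftrightarrow> (\<forall>i. P (Inl i)) \<and> (\<forall>i. P (Inr i))"
  by (metis sum.exhaust)

lemma inner_pair: "pair a b \<bullet> pair c d = a \<bullet> c + b \<bullet> d"
  unfolding inner_vec_def UNIV_sum
  by (subst sum.union_disjoint) (auto simp: sum.reindex pair_def)

lemma inner_parts: "x \<bullet> y = part1 x \<bullet> part1 y + part2 x \<bullet> part2 y"
  by (metis inner_pair pair_parts)

lemma pair_simps: "pair a b $ Inl i = a $ i" "pair a b $ Inr i = b $ i"
  by (simp_all add: pair_def)

lemma part_simps: "part1 x $ i = x $ Inl i" "part2 x $ i = x $ Inr i"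
  by (simp_all add: part1_def part2_def)

text \<open>
  These rules turn an identity between octonions into polynomial identities in their eight
  coordinates.
\<close>

lemmas oct_coordinates =
  vec_eq_iff forall_sum forall_4 inner_parts inner_vec_def sum_4 pair_simps part_simps
  oct_mult_def Let_def oct_cnj_def quat_mult_def quat_cnj_def vector_4 oct_e0_def

lemma oct_e0_mult [simp]: "oct_e0 \<odot> x = x" "x \<odot> oct_e0 = x"
  by (simp_all add: oct_coordinates axis_def)

lemma oct_cnj_cnj [simp]: "oct_cnj (oct_cnj x) = x"
  by (simp add: oct_coordinates)

lemma oct_cnj_e0 [simp]: "oct_cnj oct_e0 = oct_e0"
  by (simp add: oct_coordinates axis_def)

lemma oct_cnj_Im: "oct_cnj u = - u" if "u \<bullet> oct_e0 = 0"
  using that by (simp add: oct_coordinates axis_def)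

lemma inner_oct_cnj: "oct_cnj x \<bullet> oct_cnj y = x \<bullet> y"
  by (simp add: oct_coordinates)

lemma oct_cnj_mult: "oct_cnj (x \<odot> y) = oct_cnj y \<odot> oct_cnj x"
  by (simp add: oct_coordinates algebra_simps)

lemma inner_oct_mult_left: "(x \<odot> y) \<bullet> z = y \<bullet> (oct_cnj x \<odot> z)"
  by (simp add: oct_coordinates algebra_simps)

text \<open>
  The alternative law \<open>cnj x (x z) = \<parallel>x\<parallel>\<^sup>2 z\<close>, polarised in \<open>x\<close>: this form also makes orthogonal
  imaginary factors anticommute.
\<close>

lemma oct_cnj_mult_polar: 
  "oct_cnj x \<odot> (y \<odot> z) + oct_cnj y \<odot> (x \<odot> z) = (2 * (x \<bullet> y)) *\<^sub>R z"
  by (simp add: oct_coordinates algebra_simps)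

lemma oct_mult_cnj_polar: "x \<odot> oct_cnj y + y \<odot> oct_cnj x = (2 * (x \<bullet> y)) *\<^sub>R oct_e0"
  by (simp add: oct_coordinates axis_def algebra_simps)

lemma oct_mult_minus_zero [simp]:
  "(- x) \<odot> y = - (x \<odot> y)" "x \<odot> (- y) = - (x \<odot> y)" "0 \<odot> y = 0" "x \<odot> 0 = 0"
  "oct_cnj (- x) = - oct_cnj x"
  using linear_oct(3)[of "-1" x y] linear_oct(4)[of x "-1" y] linear_oct(3)[of 0 x y]
    linear_oct(4)[of x 0 y] linear_oct(6)[of "-1" x] by simp_all

lemma oct_mult_diff:
  "(x - x') \<odot> y = x \<odot> y - x' \<odot> y" "x \<odot> (y - y') = x \<odot> y - x \<odot> y'"
  "oct_cnj (x - x') = oct_cnj x - oct_cnj x'"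
  using linear_oct(1)[of x "- x'" y] linear_oct(2)[of x y "- y'"] linear_oct(5)[of x "- x'"]
  by simp_all

lemmas oct_linear = linear_oct oct_mult_diff

lemma inner_oct_mult_right: "(x \<odot> y) \<bullet> z = x \<bullet> (z \<odot> oct_cnj y)"
proof -
  have "(x \<odot> y) \<bullet> z = (oct_cnj y \<odot> oct_cnj x) \<bullet> oct_cnj z"
    by (metis inner_oct_cnj oct_cnj_mult)
  also have "\<dots> = oct_cnj x \<bullet> (y \<odot> oct_cnj z)"
    by (simp add: inner_oct_mult_left)
  also have "\<dots> = x \<bullet> (z \<odot> oct_cnj y)"
    by (metis inner_oct_cnj oct_cnj_cnj oct_cnj_mult)
  finally show ?thesis .
qed

lemma oct_cnj_mult_cancel: "oct_cnj x \<odot> (x \<odot> y) = (x \<bullet> x) *\<^sub>R y"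
proof -
  have "2 *\<^sub>R (oct_cnj x \<odot> (x \<odot> y)) = 2 *\<^sub>R ((x \<bullet> x) *\<^sub>R y)"
    using oct_cnj_mult_polar[of x x y] unfolding scaleR_scaleR by (simp only: scaleR_2)
  then show ?thesis by (rule scaleR_left_imp_eq[rotated]) simp
qed

lemma oct_mult_cnj_cancel: "(y \<odot> x) \<odot> oct_cnj x = (x \<bullet> x) *\<^sub>R y"
  using arg_cong[OF oct_cnj_mult_cancel[of "oct_cnj x" "oct_cnj y"], of oct_cnj]
  by (simp add: oct_cnj_mult linear_oct inner_oct_cnj)

section \<open>The associator\<close>

definition oct_assoc :: "octonion \<Rightarrow> octonion \<Rightarrow> octonion \<Rightarrow> octonion" where
  "oct_assoc x y z = (x \<odot> y) \<odot> z - x \<odot> (y \<odot> z)"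

lemma oct_assoc_linear:
  "oct_assoc (x + x') y z = oct_assoc x y z + oct_assoc x' y z"
  "oct_assoc x (y + y') z = oct_assoc x y z + oct_assoc x y' z"
  "oct_assoc x y (z + z') = oct_assoc x y z + oct_assoc x y z'"
  "oct_assoc (r *\<^sub>R x) y z = r *\<^sub>R oct_assoc x y z"
  "oct_assoc x (r *\<^sub>R y) z = r *\<^sub>R oct_assoc x y z"
  "oct_assoc x y (r *\<^sub>R z) = r *\<^sub>R oct_assoc x y z"
  "oct_assoc (- x) y z = - oct_assoc x y z"
  "oct_assoc x (- y) z = - oct_assoc x y z"
  "oct_assoc x (y - y') z = oct_assoc x y z - oct_assoc x y' z"
  "oct_assoc x y (- z) = - oct_assoc x y z"
  by (simp_all add: oct_assoc_def oct_linear algebra_simps)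

lemma oct_assoc_e0 [simp]:
  "oct_assoc oct_e0 y z = 0" "oct_assoc x oct_e0 z = 0" "oct_assoc x y oct_e0 = 0"
  by (simp_all add: oct_assoc_def)

lemma oct_re_im: "x = oct_re x *\<^sub>R oct_e0 + oct_im x"
  by (simp add: oct_im_def)

lemma oct_im_e0 [simp]: "oct_im x \<bullet> oct_e0 = 0"
  using oct_decomposition[of x "oct_re x" "oct_im x"] by (simp add: oct_Im_space_def)

lemma oct_assoc_im:
  "oct_assoc (oct_im x) y z = oct_assoc x y z" "oct_assoc x (oct_im y) z = oct_assoc x y z"
  "oct_assoc x y (oct_im z) = oct_assoc x y z"
  using oct_assoc_linear(1)[of "oct_re x *\<^sub>R oct_e0" "oct_im x" y z]
    oct_assoc_linear(2)[of x "oct_re y *\<^sub>R oct_e0" "oct_im y" z]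
    oct_assoc_linear(3)[of x y "oct_re z *\<^sub>R oct_e0" "oct_im z"]
  by (simp_all add: oct_assoc_linear(4-6) flip: oct_re_im)

lemma oct_cnj_re_im: "oct_cnj x = oct_re x *\<^sub>R oct_e0 - oct_im x"
proof -
  have "oct_cnj x = oct_cnj (oct_re x *\<^sub>R oct_e0 + oct_im x)" by (simp flip: oct_re_im)
  then show ?thesis by (simp add: linear_oct oct_cnj_Im)
qed

text \<open>
  The associator depends only on the imaginary parts, and conjugation negates those.
\<close>

lemma oct_assoc_cnj:
  "oct_assoc (oct_cnj x) y z = - oct_assoc x y z" "oct_assoc x (oct_cnj y) z = - oct_assoc x y z"
  "oct_assoc x y (oct_cnj z) = - oct_assoc x y z"
proof -
  have im: "oct_im (oct_cnj a) = - oct_im a" for a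
    using oct_decomposition[of "oct_cnj a" "oct_re a" "- oct_im a"]
    by (simp add: oct_cnj_re_im oct_Im_space_def)
  show "oct_assoc (oct_cnj x) y z = - oct_assoc x y z" "oct_assoc x (oct_cnj y) z = - oct_assoc x y z"
    "oct_assoc x y (oct_cnj z) = - oct_assoc x y z"
    using oct_assoc_im[of "oct_cnj x" y z] oct_assoc_im[of x "oct_cnj y" z] 
      oct_assoc_im[of x y "oct_cnj z"]
    by (simp_all add: im oct_assoc_linear oct_assoc_im)
qed

text \<open>
  The first identity is the polarised alternative law, as the \<open>e\<^sub>0\<close> part of \<open>x\<close> and \<open>y\<close> is invisible to
  the associator; conjugation reverses the arguments and turns it into the second.
\<close>

lemma oct_assoc_swap: "oct_assoc y x z = - oct_assoc x y z" "oct_assoc x z y = - oct_assoc x y z"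
proof -
  have left: "oct_assoc y x z = - oct_assoc x y z" for x y z
  proof -
    have "oct_assoc (oct_cnj x) y z + oct_assoc (oct_cnj y) x z
      = (oct_cnj x \<odot> y + oct_cnj y \<odot> x) \<odot> z - (oct_cnj x \<odot> (y \<odot> z) + oct_cnj y \<odot> (x \<odot> z))"
      by (simp add: oct_assoc_def linear_oct)
    also have "\<dots> = 0"
      using oct_cnj_mult_polar[of x y oct_e0] oct_cnj_mult_polar[of x y z] by (simp add: linear_oct)
    finally show ?thesis by (simp add: oct_assoc_cnj)
  qed
  have cnj: "oct_cnj (oct_assoc x y z) = oct_assoc z y x" for x y z
  proof -
    have "oct_cnj (oct_assoc x y z) = - oct_assoc (oct_cnj z) (oct_cnj y) (oct_cnj x)"
      by (simp add: oct_assoc_def oct_mult_diff oct_cnj_mult)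
    then show ?thesis by (simp add: oct_assoc_cnj)
  qed
  show "oct_assoc y x z = - oct_assoc x y z" by (rule left)
  show "oct_assoc x z y = - oct_assoc x y z"
    by (metis cnj left oct_mult_minus_zero(5))
qed

lemma oct_assoc_flip: "oct_assoc z y x = - oct_assoc x y z"
  by (metis oct_assoc_swap minus_minus)

lemma oct_assoc_flexible [simp]: "oct_assoc x y x = 0"
  using oct_assoc_flip[of x y x] by (simp add: eq_neg_iff_add_eq_0 flip: scaleR_2)

lemma oct_Im_mult:
  assumes "u \<bullet> oct_e0 = 0"
  shows "u \<odot> (u \<odot> x) = - ((u \<bullet> u) *\<^sub>R x)" "(x \<odot> u) \<odot> u = - ((u \<bullet> u) *\<^sub>R x)"
    "(u \<odot> x) \<bullet> y = - (x \<bullet> (u \<odot> y))" "(x \<odot> u) \<bullet> y = - (x \<bullet> (y \<odot> u))"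
  using oct_cnj_mult_cancel[of u x] oct_mult_cnj_cancel[of x u]
    inner_oct_mult_left[of u x y] inner_oct_mult_right[of x u y]
  by (simp_all add: oct_cnj_Im[OF assms] minus_equation_iff[of _ "_ *\<^sub>R _"] eq_commute)

lemma oct_Im_anticommute:
  assumes "u \<bullet> oct_e0 = 0" "w \<bullet> oct_e0 = 0" "u \<bullet> w = 0"
  shows "u \<odot> w = - (w \<odot> u)" "u \<odot> (w \<odot> x) = - (w \<odot> (u \<odot> x))"
proof -
  have "u \<odot> w + w \<odot> u = 0" "u \<odot> (w \<odot> x) + w \<odot> (u \<odot> x) = 0"
    using oct_mult_cnj_polar[of u w] oct_cnj_mult_polar[of u w x] assms
    by (simp_all add: oct_cnj_Im add_eq_0_iff)
  then show "u \<odot> w = - (w \<odot> u)" "u \<odot> (w \<odot> x) = - (w \<odot> (u \<odot> x))"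
    by (simp_all add: eq_neg_iff_add_eq_0)
qed

text \<open>
  The subalgebra generated by \<open>u\<close> and \<open>w\<close> is associative; for the elements that matter here the
  alternative laws suffice to check this.
\<close>

lemma oct_assoc_on_quaternions:
  assumes u: "u \<bullet> oct_e0 = 0" and w: "w \<bullet> oct_e0 = 0"
    and "x \<in> {oct_e0, u, w, u \<odot> w}"
  shows "oct_assoc u x w = 0"
proof -
  note sq = oct_Im_mult(1)[OF u] oct_Im_mult(2)[OF w] 
    oct_Im_mult(1)[OF u, of oct_e0] oct_Im_mult(2)[OF w, of oct_e0]
  show ?thesis using assms(3) sq
    by (auto simp: oct_assoc_def oct_linear)
qed

text \<open>
  Let \<open>V\<close> be the orthogonal complement of \<open>e\<^sub>0, u, w, u w\<close>. It is stable under multiplication by \<open>u\<close>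
  from the left and by \<open>w\<close> from the right. For \<open>x\<close> in \<open>V\<close>, swapping orthogonal imaginary factors three
  times gives \<open>u (x w) = - (u x) w\<close>, so the associator of
  \<open>u, x, w\<close> is \<open>2 (u x) w\<close>, again in \<open>V\<close>. Applying this twice and moving \<open>u\<close> past \<open>w\<close> once more brings
  \<open>u u\<close> and \<open>w w\<close> together.
\<close>

lemma oct_assoc_off_quaternions:
  assumes u: "u \<bullet> oct_e0 = 0" and w: "w \<bullet> oct_e0 = 0" and uw: "u \<bullet> w = 0"
    and x: "\<And>q. q \<in> {oct_e0, u, w, u \<odot> w} \<Longrightarrow> q \<bullet> x = 0"
  shows "oct_assoc u (oct_assoc u x w) w = - ((4 * (u \<bullet> u) * (w \<bullet> w)) *\<^sub>R x)"
proof -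
  define V where "V = {x. x \<bullet> oct_e0 = 0 \<and> x \<bullet> u = 0 \<and> x \<bullet> w = 0 \<and> x \<bullet> (u \<odot> w) = 0}"
  note sq = oct_Im_mult(1)[OF u, of oct_e0] oct_Im_mult(2)[OF w, of oct_e0]
    oct_Im_mult(1)[OF u] oct_Im_mult(2)[OF w] 
  have wu: "w \<odot> u = - (u \<odot> w)"
    using oct_Im_anticommute(1)[OF u w uw] by simp
  have closed: "u \<odot> x \<in> V" "x \<odot> w \<in> V" if "x \<in> V" for x
    using that sq by (auto simp: V_def oct_Im_mult(3)[OF u] oct_Im_mult(4)[OF w] wu)
  have move: "u \<odot> (x \<odot> w) = - ((u \<odot> x) \<odot> w)" if "x \<in> V" for x
  proof -
    have 1: "x \<bullet> oct_e0 = 0" "x \<bullet> w = 0" "(u \<odot> x) \<bullet> oct_e0 = 0" "(u \<odot> x) \<bullet> w = 0"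
      using that closed(1)[OF that] by (auto simp: V_def)
    have "u \<odot> (x \<odot> w) = - (u \<odot> (w \<odot> x))"
      using oct_Im_anticommute(1)[OF 1(1) w 1(2)] by simp
    also have "\<dots> = w \<odot> (u \<odot> x)"
      using oct_Im_anticommute(2)[OF u w uw] by simp
    also have "\<dots> = - ((u \<odot> x) \<odot> w)"
      using oct_Im_anticommute(1)[OF 1(3) w 1(4)] by simp
    finally show ?thesis .
  qed
  have assoc: "oct_assoc u x w = 2 *\<^sub>R ((u \<odot> x) \<odot> w)" if "x \<in> V" for x
    using move[OF that] by (simp add: oct_assoc_def scaleR_2)
  have "x \<in> V"
    using x[of oct_e0] x[of u] x[of w] x[of "u \<odot> w"] by (simp add: V_def inner_commute)
  have "oct_assoc u (oct_assoc u x w) w = 4 *\<^sub>R ((u \<odot> ((u \<odot> x) \<odot> w)) \<odot> w)"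
    using assoc \<open>x \<in> V\<close> closed by (simp add: oct_assoc_linear)
  also have "\<dots> = - (4 *\<^sub>R (((u \<odot> (u \<odot> x)) \<odot> w) \<odot> w))"
    using move \<open>x \<in> V\<close> closed by simp
  also have "\<dots> = - ((4 * (u \<bullet> u) * (w \<bullet> w)) *\<^sub>R x)"
    using sq by (simp add: linear_oct)
  finally show ?thesis .
qed

section \<open>Left multiplication\<close>

definition sed_cnj :: "sedenion \<Rightarrow> sedenion" where
  "sed_cnj v = pair (oct_cnj (part1 v)) (- part2 v)"

definition sed_flip :: "sedenion \<Rightarrow> sedenion" where
  "sed_flip v = pair (part1 v) (- part2 v)"

text \<open>
  The amount by which \<open>v\<^sup>* (v y)\<close> differs from \<open>D1 v *\<^sub>R y\<close>.
\<close>

definition sed_defect :: "sedenion \<Rightarrow> sedenion \<Rightarrow> sedenion" where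
  "sed_defect v y = pair (oct_assoc (part1 v) (part2 y) (part2 v))
                        (- oct_assoc (part1 v) (part1 y) (part2 v))"

lemma pair_eq_iff: "pair a b = pair c d \<longleftrightarrow> a = c \<and> b = d"
  by (metis part1_pair part2_pair)

lemma pair_0: "pair 0 0 = 0"
  by (simp add: vec_eq_iff forall_sum pair_simps)

lemma left_mult_pair:
  "left_mult (pair a b) (pair c d) = pair (a \<odot> c - oct_cnj d \<odot> b) (d \<odot> a + b \<odot> oct_cnj c)"
  by (simp add: left_mult_def sed_mult_def)

lemma D1_pair: "D1 (pair a b) = a \<bullet> a + b \<bullet> b"
  by (simp add: D1_def power2_norm_eq_inner)

text \<open>
  Each component of \<open>v\<^sup>* (v y)\<close> contains two products that collapse by the alternative law; the other
  two would cancel if multiplication were associative, and leave an associator.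
\<close>

lemma left_mult_cnj_left_mult: "left_mult (sed_cnj v) (left_mult v y) = D1 v *\<^sub>R y + sed_defect v y"
proof -
  obtain a b c d where v: "v = pair a b" and y: "y = pair c d" by (metis pair_parts)
  have 1: "oct_cnj a \<odot> (a \<odot> c - oct_cnj d \<odot> b) - oct_cnj (d \<odot> a + b \<odot> oct_cnj c) \<odot> (- b)
    = (a \<bullet> a + b \<bullet> b) *\<^sub>R c + oct_assoc a d b"
  proof -
    have "(c \<odot> oct_cnj b) \<odot> b = (b \<bullet> b) *\<^sub>R c"
      using oct_mult_cnj_cancel[of c "oct_cnj b"] by (simp add: inner_oct_cnj)
    moreover have "oct_assoc a d b = oct_assoc (oct_cnj a) (oct_cnj d) b"
      by (simp add: oct_assoc_cnj)
    ultimately show ?thesis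
      by (simp add: oct_linear oct_cnj_mult oct_cnj_mult_cancel oct_assoc_def algebra_simps)
  qed
  have 2: "(d \<odot> a + b \<odot> oct_cnj c) \<odot> oct_cnj a + (- b) \<odot> oct_cnj (a \<odot> c - oct_cnj d \<odot> b)
    = (a \<bullet> a + b \<bullet> b) *\<^sub>R d + - oct_assoc a c b"
  proof -
    have "b \<odot> (oct_cnj b \<odot> d) = (b \<bullet> b) *\<^sub>R d"
      using oct_cnj_mult_cancel[of "oct_cnj b" d] by (simp add: inner_oct_cnj)
    moreover have "- oct_assoc a c b = oct_assoc b (oct_cnj c) (oct_cnj a)"
      by (simp add: oct_assoc_cnj oct_assoc_flip[of b c a])
    ultimately show ?thesis
      by (simp add: oct_linear oct_cnj_mult oct_mult_cnj_cancel oct_assoc_def algebra_simps)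
  qed
  show ?thesis unfolding v y
    by (simp only: sed_cnj_def sed_defect_def left_mult_pair part1_pair part2_pair 1 2 D1_pair
      linear_pair_parts(1,2)[symmetric])
qed

lemma adjoint_left_mult: "adjoint (left_mult v) = left_mult (sed_cnj v)"
proof (rule adjoint_unique, intro allI)
  fix x y
  obtain a b c d p q :: octonion
    where v: "v = pair a b" and "x = pair c d" "y = pair p q" by (metis pair_parts)
  have "(oct_cnj d \<odot> b) \<bullet> p = d \<bullet> (b \<odot> oct_cnj p)"
    by (metis inner_oct_cnj inner_oct_mult_right oct_cnj_cnj oct_cnj_mult)
  moreover have "(b \<odot> oct_cnj c) \<bullet> q = c \<bullet> (oct_cnj q \<odot> b)"
    by (metis inner_oct_cnj inner_oct_mult_left oct_cnj_cnj oct_cnj_mult)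
  ultimately show "left_mult v x \<bullet> y = x \<bullet> left_mult (sed_cnj v) y"
    unfolding \<open>x = _\<close> \<open>y = _\<close> v
    by (simp add: sed_cnj_def left_mult_pair inner_pair inner_oct_mult_left[of a]
      inner_oct_mult_right[of d a] inner_add_left inner_add_right inner_diff_left inner_diff_right)
qed

text \<open>
  \<open>left_mult v\<close> is skew up to the scalar \<open>oct_re (part1 v)\<close>: the terms containing \<open>part2 v\<close> cancel, and
  only the symmetric part of \<open>part1 v\<close> contributes.
\<close>

lemma inner_left_mult: "y \<bullet> left_mult v y = oct_re (part1 v) * (y \<bullet> y)"
proof -
  obtain a b c d where v: "v = pair a b" and y: "y = pair c d" by (metis pair_parts)
  have a: "a + oct_cnj a = (2 * oct_re a) *\<^sub>R oct_e0"
    using oct_mult_cnj_polar[of a oct_e0] by (simp add: oct_re_def)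
  have "(a \<odot> c) \<bullet> c + (oct_cnj a \<odot> c) \<bullet> c = 2 * oct_re a * (c \<bullet> c)"
    using arg_cong[OF a, of "\<lambda>s. (s \<odot> c) \<bullet> c"] by (simp add: linear_oct inner_add_left)
  moreover have "(a \<odot> c) \<bullet> c = (oct_cnj a \<odot> c) \<bullet> c"
    by (metis inner_oct_mult_left inner_commute)
  moreover have "(d \<odot> a) \<bullet> d + (d \<odot> oct_cnj a) \<bullet> d = 2 * oct_re a * (d \<bullet> d)"
    using arg_cong[OF a, of "\<lambda>s. (d \<odot> s) \<bullet> d"] by (simp add: linear_oct inner_add_left)
  moreover have "(d \<odot> a) \<bullet> d = (d \<odot> oct_cnj a) \<bullet> d"
    by (metis inner_oct_mult_right inner_commute)
  moreover have "(oct_cnj d \<odot> b) \<bullet> c = (b \<odot> oct_cnj c) \<bullet> d"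
    by (simp add: inner_oct_mult_left[of _ b c] inner_oct_mult_right[of b _ d])
  ultimately show ?thesis unfolding v y
    by (simp add: left_mult_pair inner_pair inner_commute[of c "_ \<odot> _"] inner_commute[of d "_ \<odot> _"]
      inner_add_right inner_diff_right distrib_left)
qed

lemma linear_sed_flip: "linear sed_flip"
  by (rule linearI) (simp_all add: sed_flip_def linear_pair_parts flip: linear_pair_parts(1,2) )

lemma left_mult_sed_flip: "left_mult (sed_flip v) (sed_flip y) = sed_flip (left_mult v y)"
proof -
  obtain a b c d where "v = pair a b" "y = pair c d" by (metis pair_parts)
  then show ?thesis by (simp add: sed_flip_def left_mult_pair)
qed

text \<open>
  \<open>sed_flip\<close> is an involutive automorphism of the sedenions, hence conjugates \<open>left_mult v\<close> into
  \<open>left_mult (sed_flip v)\<close>.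
\<close>

lemma \<Delta>_sed_flip: "\<Delta> (sed_flip v) = \<Delta> v"
proof -
  have "sed_flip \<circ> sed_flip = id"
    by (auto simp: sed_flip_def)
  then have "matrix sed_flip ** matrix sed_flip = mat 1"
    using matrix_compose[OF linear_sed_flip linear_sed_flip] by (simp add: matrix_id_mat_1)
  then have nz: "det (matrix sed_flip) \<noteq> 0"
    by (metis det_I det_mul mult_zero_left zero_neq_one)
  have "left_mult (sed_flip v) \<circ> sed_flip = sed_flip \<circ> left_mult v"
    by (auto simp: left_mult_sed_flip)
  then have "matrix (left_mult (sed_flip v)) ** matrix sed_flip = matrix sed_flip ** matrix (left_mult v)"
    by (metis linear_left_mult linear_sed_flip matrix_compose)
  from arg_cong[OF this, of det]
  have "\<Delta> (sed_flip v) * det (matrix sed_flip) = det (matrix sed_flip) * \<Delta> v"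
    by (simp only: det_mul \<Delta>_def)
  with nz show ?thesis by simp
qed

lemma \<Delta>_sed_cnj: "\<Delta> (sed_cnj v) = \<Delta> v"
  using matrix_adjoint[OF linear_left_mult, of v] by (simp add: \<Delta>_def adjoint_left_mult)

text \<open>
  The operator \<open>adjoint (left_mult v) \<circ> left_mult v\<close>, given by its closed form.
\<close>

definition sed_gram :: "sedenion \<Rightarrow> sedenion \<Rightarrow> sedenion" where
  "sed_gram v y = D1 v *\<^sub>R y + sed_defect v y"

lemma sed_gram_altdef: "sed_gram v = left_mult (sed_cnj v) \<circ> left_mult v"
  by (auto simp: sed_gram_def left_mult_cnj_left_mult)

lemma linear_sed_gram: "linear (sed_gram v)"
  unfolding sed_gram_altdef by (intro linear_compose linear_left_mult)

lemma det_sed_gram: "det (matrix (sed_gram v)) = \<Delta> v ^ 2"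
  unfolding sed_gram_altdef
  by (simp add: matrix_compose linear_left_mult det_mul \<Delta>_sed_cnj power2_eq_square flip: \<Delta>_def)

lemma sed_flip_simps [simp]:
  "part1 (sed_flip v) = part1 v" "part2 (sed_flip v) = - part2 v" "D1 (sed_flip v) = D1 v"
  by (simp_all add: D1_def sed_flip_def)

text \<open>
  \<open>sed_flip\<close> reverses the sign of the defect, so the product is a difference of squares: the mixed
  terms cancel and both halves of \<open>y\<close> decouple.
\<close>

lemma sed_gram_flip:
  "sed_gram v (sed_gram (sed_flip v) y) = 
    pair (D1 v ^ 2 *\<^sub>R part1 y + oct_assoc (part1 v) (oct_assoc (part1 v) (part1 y) (part2 v)) (part2 v))
         (D1 v ^ 2 *\<^sub>R part2 y + oct_assoc (part1 v) (oct_assoc (part1 v) (part2 y) (part2 v)) (part2 v))"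
proof -
  obtain c d where "y = pair c d" by (metis pair_parts)
  then show ?thesis 
    by (simp add: sed_gram_def sed_defect_def linear_pair_parts(3-)
        oct_assoc_linear power2_eq_square scaleR_add_right scaleR_diff_right pair_eq_iff flip: linear_pair_parts(1,2))
qed

text \<open>
  The operator \<open>F\<close> below has determinant \<open>\<Delta>\<^sup>4\<close> and preserves the splitting of each octonion half into
  the span of \<open>Q\<close> and its complement. The dimension count needs \<open>Q\<close> to consist of four nonzero
  vectors; if it does not, the Gram determinant of \<open>u\<close> and \<open>w\<close> is zero, \<open>D2 = D1\<^sup>2\<close>, and \<open>F\<close> is scalar.
\<close>

lemma \<Delta>_power4: "\<Delta> v ^ 4 = (D1 v ^ 4 * D2 v ^ 2) ^ 4"
proof -
  define u w where "u = oct_im (part1 v)" and "w = oct_im (part2 v)"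
  \<comment> \<open>For \<open>u = 0\<close> the quotient is \<open>0\<close>, so that \<open>z\<close> is orthogonal to \<open>u\<close> in every case.\<close>
  define z where "z = w - ((u \<bullet> w) / (u \<bullet> u)) *\<^sub>R u"
  define T where "T x = oct_assoc (part1 v) x (part2 v)" for x
  define F where "F = sed_gram v \<circ> sed_gram (sed_flip v)"
  define Q where "Q = {oct_e0, u, z, u \<odot> z}"
  define B where "B = (\<lambda>q. pair q 0) ` Q \<union> pair 0 ` Q"
  have u: "u \<bullet> oct_e0 = 0" and w: "w \<bullet> oct_e0 = 0" by (simp_all add: u_def w_def)
  have z: "z \<bullet> oct_e0 = 0" using u w by (simp add: z_def inner_diff_left)
  have uz: "u \<bullet> z = 0" by (simp add: z_def inner_diff_right)
  have T: "T x = oct_assoc u x z" for x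
  proof -
    have "w = z + ((u \<bullet> w) / (u \<bullet> u)) *\<^sub>R u" by (simp add: z_def)
    then have "oct_assoc u x w = oct_assoc u x z" 
      by (metis (no_types, lifting) oct_assoc_linear(3,6) oct_assoc_flexible scaleR_zero_right add.right_neutral)
    then show ?thesis by (simp add: T_def u_def w_def oct_assoc_im)
  qed
  have D2: "D2 v = D1 v ^ 2 - 4 * (u \<bullet> u) * (z \<bullet> z)"
  proof (cases "u = 0")
    case False
    then show ?thesis
      by (simp add: D2_def Let_def power2_norm_eq_inner flip: u_def w_def)
        (simp add: z_def inner_diff_left inner_diff_right inner_commute field_simps power2_eq_square)
  qed (simp add: D2_def flip: u_def)
  have F: "F y = pair (D1 v ^ 2 *\<^sub>R part1 y + T (T (part1 y))) (D1 v ^ 2 *\<^sub>R part2 y + T (T (part2 y)))" for y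
    by (simp add: F_def sed_gram_flip T_def)
  have onQ: "T (T q) = 0" if "q \<in> Q" for q
    using oct_assoc_on_quaternions[OF u z, of q] oct_assoc_linear(5)[of u 0 0 z] that 
    by (simp add: T Q_def)
  have offQ: "D1 v ^ 2 *\<^sub>R x + T (T x) = D2 v *\<^sub>R x" if "\<And>q. q \<in> Q \<Longrightarrow> q \<bullet> x = 0" for x
    using oct_assoc_off_quaternions[OF u z uz, of x] that 
    by (simp add: T Q_def D2 algebra_simps)
  have "T 0 = 0" using oct_assoc_linear(5)[of u 0 0 z] by (simp add: T)
  have onB: "F y = D1 v ^ 2 *\<^sub>R y" if "y \<in> B" for y
    using that onQ \<open>T 0 = 0\<close> by (auto simp: B_def F simp flip: linear_pair_parts(2))
  have offB: "F y = D2 v *\<^sub>R y" if "\<And>b. b \<in> B \<Longrightarrow> b \<bullet> y = 0" for y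
  proof -
    obtain c d where y: "y = pair c d" by (metis pair_parts)
    have "pair q 0 \<bullet> y = 0" "pair 0 q \<bullet> y = 0" if "q \<in> Q" for q
      using that by (auto intro!: \<open>\<And>b. b \<in> B \<Longrightarrow> b \<bullet> y = 0\<close> simp: B_def)
    then have "q \<bullet> c = 0" "q \<bullet> d = 0" if "q \<in> Q" for q
      using that by (simp_all add: y inner_pair)
    then show ?thesis
      by (simp add: F y offQ linear_pair_parts(2))
  qed
  have linF: "linear F" unfolding F_def by (intro linear_compose linear_sed_gram)
  have "det (matrix F) = (D1 v ^ 2) ^ 8 * D2 v ^ 8"
  proof (cases "u = 0 \<or> z = 0")
    case True
    then have "D2 v = D1 v ^ 2" using D2 by auto
    \<comment> \<open>\<open>F\<close> is the scalar \<open>D2 v\<close>, which is the case of an empty \<open>B\<close>.\<close>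
    have "det (matrix F) = (D1 v ^ 2) ^ card ({}::sedenion set) * D2 v ^ (CARD((4+4)+(4+4)) - card ({}::sedenion set))"
    proof (rule det_two_eigenspaces[OF linF])
      fix y
      have "T x = 0" for x
        using True by (auto simp: T oct_assoc_def)
      then show "F y = D2 v *\<^sub>R y"
        by (simp add: F \<open>D2 v = D1 v ^ 2\<close> linear_pair_parts(2))
    qed auto
    then show ?thesis by (simp add: \<open>D2 v = D1 v ^ 2\<close> flip: power_add)
  next
    case False
    then have "u \<noteq> 0" "z \<noteq> 0" by auto
    have "oct_e0 \<bullet> oct_e0 = 1" by (simp add: dot_square_norm)
    then have "oct_e0 \<noteq> 0" by auto
    have "u \<odot> z \<noteq> 0"
      using oct_Im_mult(1)[OF u, of z] \<open>u \<noteq> 0\<close> \<open>z \<noteq> 0\<close> by auto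
    have dots: "oct_e0 \<bullet> u = 0" "oct_e0 \<bullet> z = 0" "u \<bullet> z = 0"
      "oct_e0 \<bullet> (u \<odot> z) = 0" "u \<bullet> (u \<odot> z) = 0" "z \<bullet> (u \<odot> z) = 0"
      using u z uz oct_Im_mult(3)[OF u, of z oct_e0] oct_Im_mult(3)[OF u, of z u]
        oct_Im_mult(4)[OF z, of u z] oct_Im_mult(1)[OF u, of oct_e0] oct_Im_mult(2)[OF z, of oct_e0]
      by (simp_all add: inner_commute)
    have "0 \<notin> Q"
      using \<open>oct_e0 \<noteq> 0\<close> \<open>u \<noteq> 0\<close> \<open>z \<noteq> 0\<close> \<open>u \<odot> z \<noteq> 0\<close> by (auto simp: Q_def)
    have distinct: "oct_e0 \<noteq> u" "oct_e0 \<noteq> z" "oct_e0 \<noteq> u \<odot> z" "u \<noteq> z" "u \<noteq> u \<odot> z" "z \<noteq> u \<odot> z"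
      using dots \<open>0 \<notin> Q\<close> by (metis Q_def inner_eq_zero_iff insertCI)+
    then have "finite Q" "card Q = 4" by (simp_all add: Q_def)
    have orthQ: "p \<bullet> q = 0" if "p \<in> Q" "q \<in> Q" "p \<noteq> q" for p q
      using that dots unfolding Q_def by (auto simp: inner_commute)
    have orthB: "pairwise orthogonal B"
      using orthQ by (auto simp: pairwise_def orthogonal_def B_def inner_pair pair_eq_iff)
    have "0 \<notin> B"
      using \<open>0 \<notin> Q\<close> by (auto simp: B_def pair_eq_iff simp flip: pair_0)
    have "card B = card Q + card Q"
      unfolding B_def using \<open>0 \<notin> Q\<close>
      by (subst card_Un_disjoint) (auto simp: \<open>finite Q\<close> pair_eq_iff card_image inj_on_def)
    then have "card B = 8" using \<open>card Q = 4\<close> by simp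
    then show ?thesis
      using det_two_eigenspaces[OF linF orthB \<open>0 \<notin> B\<close>, of "D1 v ^ 2" "D2 v"] onB offB \<open>card B = 8\<close> by simp
  qed
  moreover have "det (matrix F) = \<Delta> v ^ 4"
    by (simp add: F_def matrix_compose linear_sed_gram det_mul det_sed_gram \<Delta>_sed_flip flip: power_add)
  ultimately show ?thesis by (simp add: power_mult_distrib flip: power_mult)
qed

text \<open>
  The sign of \<open>oct_re (part1 v)\<close> decides whether the form of \<open>left_mult v\<close> or of its negative is
  nonnegative; in dimension 16 both have the same determinant.
\<close>

lemma \<Delta>_nonneg: "0 \<le> \<Delta> v"
proof (cases "0 \<le> oct_re (part1 v)")
  case True
  then show ?thesis unfolding \<Delta>_def
    by (intro det_nonneg_if_form_nonneg linear_left_mult) (simp add: inner_left_mult)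
next
  case False
  have "0 \<le> det (matrix (\<lambda>y. - left_mult v y))"
    using False
    by (intro det_nonneg_if_form_nonneg linear_compose_neg linear_left_mult) 
      (simp add: inner_left_mult mult_nonpos_nonneg)
  also have "(\<lambda>y. - left_mult v y) = (*\<^sub>R) (-1) \<circ> left_mult v"
    by auto
  also have "det (matrix \<dots>) = \<Delta> v"
    by (subst matrix_compose) (simp_all add: linear_left_mult linear_scaleR det_mul \<Delta>_def)
  finally show ?thesis .
qed

section \<open>The determinant and the zero divisors\<close>

theorem theorem3p7:
  fixes v :: sedenion
  shows "\<Delta> v = D1 v ^ 4 * D2 v ^ 2 \<and>
         (v \<noteq> 0 \<longrightarrow> (left_zero_divisor v \<longleftrightarrow> D2 v = 0))"
proof (intro conjI impI)
  show \<Delta>: "\<Delta> v = D1 v ^ 4 * D2 v ^ 2"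
    using \<Delta>_power4 \<Delta>_nonneg by (rule power_eq_imp_eq_base) simp_all
  assume "v \<noteq> 0"
  then have "part1 v \<noteq> 0 \<or> part2 v \<noteq> 0"
    by (metis pair_0 pair_parts)
  then have "D1 v \<noteq> 0"
    by (simp add: D1_def sum_power2_eq_zero_iff)
  have "left_zero_divisor v \<longleftrightarrow> \<not> inj (left_mult v)"
    using linear_injective_0[OF linear_left_mult] by (auto simp: left_zero_divisor_def left_mult_def)
  also have "\<dots> \<longleftrightarrow> \<Delta> v = 0"
    using det_nz_iff_inj[OF linear_left_mult] by (auto simp: \<Delta>_def)
  also have "\<dots> \<longleftrightarrow> D2 v = 0"
    using \<open>D1 v \<noteq> 0\<close> by (simp add: \<Delta>)
  finally show "left_zero_divisor v \<longleftrightarrow> D2 v = 0" .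
qed

end
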